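(* Let $d_k(n)$ be as in the context and let $E_n=\frac{\sum_k k\, d_k(n)}{\sum_k d_k(n)}$ be the expected number of pieces in a uniformly random division of a honeycomb strip of length $n$. Then, as $n\to\infty$, $$E_n\sim \frac{\sqrt{5}}{5}\,n\approx 0.447214\, n.$$
   Context: A honeycomb strip of length $n$ consists of $n$ hexagons labelled $1,\dots,n$ in which hexagon $i$ is adjacent exactly with hexagons $i\pm1$ and $i\pm2$ (when these exist); equivalently its inner dual is the graph $P_n^2$ on vertices $1,\dots,n$ with $i\sim j$ iff $1\le|i-j|\le2$. $d_k(n)$ denotes the number of partitions of the hexagons into exactly $k$ blocks each inducing a connected subgraph of $P_n^2$. All divisions are equally likely. *)

theory Defs
  imports
    Complex_Main
    "HOL-Library.Disjoint_Sets"
    "HOL-Library.Landau_Symbols"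
    "Graph_Theory.Digraph_Component"
begin

text \<open>
  The inner dual of the honeycomb strip, that is the graph \<open>P\<^sub>n\<^sup>2\<close>. An undirected edge is
  represented by its two opposite arcs.
\<close>

definition strip_graph :: "nat \<Rightarrow> nat pair_pre_digraph" where
  "strip_graph n =
     \<lparr> pverts = {1..n},
       parcs = {(i, j). i \<in> {1..n} \<and> j \<in> {1..n} \<and>
                  1 \<le> \<bar>int i - int j\<bar> \<and> \<bar>int i - int j\<bar> \<le> 2} \<rparr>"

text \<open>
  The qualified name is needed because \<open>connected\<close> also denotes topological connectedness.
\<close>

definition strip_divisions :: "nat \<Rightarrow> nat set set set" where
  "strip_divisions n =
     {P. partition_on {1..n} P \<and>
         (\<forall>B\<in>P. Digraph_Component.connected (with_proj (strip_graph n) \<restriction> B))}"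

definition num_divisions :: "nat \<Rightarrow> nat \<Rightarrow> nat" where
  "num_divisions k n = card {P \<in> strip_divisions n. card P = k}"

text \<open>
  Summing over \<open>k \<le> n\<close> loses nothing: a division of \<open>n\<close> hexagons has at most \<open>n\<close> pieces.
\<close>

lemma num_divisions_eq_0: "num_divisions k n = 0" if "k > n"
proof -
  have "card P \<le> n" if "partition_on {1..n} P" for P :: "nat set set"
  proof -
    have "inj_on Min P"
      using that
      by (intro inj_onI)
        (metis Min_in disjointD disjoint_iff finite_atLeastAtMost finite_subset
          partition_onD1 partition_onD2 partition_onD3 Union_upper)
    moreover have "Min ` P \<subseteq> {1..n}"
      using that
      by (smt (verit) Min_in Union_iff finite_atLeastAtMost finite_subset image_subsetI
          partition_onD1 partition_onD3 Union_upper)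
    ultimately show ?thesis
      by (metis card_atLeastAtMost card_inj_on_le diff_Suc_1 finite_atLeastAtMost)
  qed
  then have "{P \<in> strip_divisions n. card P = k} = {}"
    using that by (force simp: strip_divisions_def)
  then show ?thesis
    by (simp only: num_divisions_def card.empty)
qed

definition expected_pieces :: "nat \<Rightarrow> real" where
  "expected_pieces n = (\<Sum>k\<le>n. real k * real (num_divisions k n)) / (\<Sum>k\<le>n. real (num_divisions k n))"

end

theory Submission
  imports Defs
begin

text \<open>
  Hexagon \<open>n + 1\<close> is adjacent only to \<open>n\<close> and \<open>n - 1\<close>, which are adjacent to each other, so
  removing it from a division of length \<open>n + 1\<close> leaves a division of length \<open>n\<close>. Conversely,
  hexagon \<open>n + 1\<close> either forms a piece of its own or joins the piece of \<open>n\<close> or of \<open>n - 1\<close>; there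
  are two or three possibilities according to whether \<open>n - 1\<close> and \<open>n\<close> lie in the same piece.
  Let \<open>A\<close>, \<open>B\<close> count the divisions of the two kinds and \<open>a\<close>, \<open>b\<close> their pieces. From \<open>n\<close> to \<open>n + 1\<close>
  these four numbers become \<open>A + B\<close>, \<open>A + 2B\<close>, \<open>a + b\<close> and \<open>a + 2b + A + B\<close>, whence \<open>a\<close> and \<open>b\<close> are
  combinations of \<open>A\<close> and \<open>B\<close> with coefficients linear in \<open>n\<close>. Finally \<open>B - \<phi>A\<close> stays bounded
  for the golden ratio \<open>\<phi>\<close>, being multiplied by \<open>2 - \<phi>\<close> at each step.
\<close>

section \<open>Connected blocks as sets without wide gaps\<close>

text \<open>A criterion free of the graph and of \<open>n\<close>, suited to adding or removing a
  largest element. Nonemptiness is included because a connected graph is required to have a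
  vertex.\<close>

definition narrow_gaps :: "nat set \<Rightarrow> bool" where
  "narrow_gaps B \<longleftrightarrow> B \<noteq> {} \<and> (\<forall>x\<in>B. \<forall>y\<in>B. x < y \<longrightarrow> x + 1 \<in> B \<or> x + 2 \<in> B)"

text \<open>Both arcs of every edge are present, so the symmetric closure in the definition of
  \<open>connected\<close> adds nothing.\<close>

lemma connected_strip_iff_reachable:
  assumes "B \<subseteq> {1..n}"
  shows "Digraph_Component.connected (with_proj (strip_graph n) \<restriction> B) \<longleftrightarrow>
    B \<noteq> {} \<and> (\<forall>u\<in>B. \<forall>v\<in>B. (u, v) \<in> rtrancl_on B
      {(i, j). i \<in> B \<and> j \<in> B \<and> i \<noteq> j \<and> i \<le> j + 2 \<and> j \<le> i + 2})"
proof -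
  have adj: "1 \<le> \<bar>int i - int j\<bar> \<and> \<bar>int i - int j\<bar> \<le> 2 \<longleftrightarrow> i \<noteq> j \<and> i \<le> j + 2 \<and> j \<le> i + 2"
    for i j
    by linarith
  let ?E = "{(i, j). i \<in> B \<and> j \<in> B \<and> i \<noteq> j \<and> i \<le> j + 2 \<and> j \<le> i + 2}"
  have "arcs (with_proj (strip_graph n) \<restriction> B) = ?E"
    unfolding induce_subgraph_arcs with_proj_simps strip_graph_def pair_pre_digraph.simps adj
    using assms by fastforce
  then have "parcs (mk_symmetric (with_proj (strip_graph n) \<restriction> B)) = (\<Union>e\<in>?E. {e, (snd e, fst e)})"
    by (simp add: parcs_mk_symmetric)
  also have "\<dots> = ?E"
    by auto
  finally have "parcs (mk_symmetric (with_proj (strip_graph n) \<restriction> B)) = ?E" .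
  then show ?thesis
    by (simp add: connected_def strongly_connected_def reachable_def)
qed

text \<open>Arcs span at most 2, so a walk cannot cross two consecutive missing numbers. Without
  such a gap one climbs from the smaller hexagon to the larger, and symmetry gives the way
  back.\<close>

lemma connected_strip_iff:
  assumes "B \<subseteq> {1..n}"
  shows "Digraph_Component.connected (with_proj (strip_graph n) \<restriction> B) \<longleftrightarrow> narrow_gaps B"
proof -
  define r where "r = {(i, j). i \<in> B \<and> j \<in> B \<and> i \<noteq> j \<and> i \<le> j + 2 \<and> j \<le> i + (2::nat)}"
  have "narrow_gaps B"
    if ne: "B \<noteq> {}" and reach: "\<And>u v. u \<in> B \<Longrightarrow> v \<in> B \<Longrightarrow> (u, v) \<in> rtrancl_on B r"
  proof -
    have "x + 1 \<in> B \<or> x + 2 \<in> B" if "x \<in> B" "y \<in> B" "x < y" for x y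
    proof (rule ccontr)
      assume gap: "\<not> (x + 1 \<in> B \<or> x + 2 \<in> B)"
      have "(x, y) \<in> rtrancl_on B r"
        using that by (intro reach)
      \<comment> \<open>A walk from \<open>x\<close> never gets above \<open>x\<close>: the next arc
        leads to at most \<open>x + 2\<close>, and the two numbers above \<open>x\<close> are
        missing from \<open>B\<close>.\<close>
      then have "y \<le> x"
      proof (induction rule: rtrancl_on_induct)
        case (step u v)
        then have "v \<le> x + 2" "v \<in> B"
          by (auto simp: r_def)
        with gap have "v \<noteq> x + 1" "v \<noteq> x + 2"
          by auto
        with \<open>v \<le> x + 2\<close> show ?case
          by linarith
      qed simp
      with \<open>x < y\<close> show False
        by simp
    qed
    with ne show ?thesis
      by (simp add: narrow_gaps_def)
  qed
  moreover have "(u, v) \<in> rtrancl_on B r" if gaps: "narrow_gaps B" and uv: "u \<in> B" "v \<in> B" for u v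
  proof -
    have up: "(x, y) \<in> rtrancl_on B r" if "x \<in> B" "y \<in> B" "x \<le> y" for x y
      using that
    proof (induction "y - x" arbitrary: x rule: less_induct)
      case less
      show ?case
      proof (cases "x = y")
        case False
        with less.prems gaps obtain z where z: "z \<in> B" "z = x + 1 \<or> z = x + 2"
          unfolding narrow_gaps_def by (metis le_neq_implies_less)
        show ?thesis
        proof (cases "z \<le> y")
          case True
          then have "(z, y) \<in> rtrancl_on B r"
            using z less by (intro less.hyps) auto
          moreover have "(x, z) \<in> r"
            using z less.prems by (auto simp: r_def)
          ultimately show ?thesis
            using less.prems by (blast intro: converse_rtrancl_on_into_rtrancl_on)
        next
          case False
          \<comment> \<open>Overshooting means \<open>z = x + 2\<close> and
            \<open>y = x + 1\<close>, so \<open>y\<close> is itself a neighbour of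
            \<open>x\<close>.\<close>
          then have "(x, y) \<in> r"
            using z less.prems \<open>x \<noteq> y\<close> by (auto simp: r_def)
          then show ?thesis
            using less.prems by (blast intro: rtrancl_on_into_rtrancl_on rtrancl_on_refl)
        qed
      qed (use less.prems in simp)
    qed
    have "sym (rtrancl_on B r)"
      by (rule rtrancl_on_sym) (auto simp: sym_def r_def)
    with up uv show ?thesis
      by (metis linear symD)
  qed
  ultimately show ?thesis
    unfolding connected_strip_iff_reachable[OF assms] r_def[symmetric]
    by (auto simp: narrow_gaps_def)
qed

section \<open>Divisions and their average number of pieces\<close>

lemma strip_divisions_altdef:
  "strip_divisions n = {P. partition_on {1..n} P \<and> (\<forall>B\<in>P. narrow_gaps B)}"
  unfolding strip_divisions_def
proof (intro Collect_cong conj_cong refl ball_cong)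
  fix P B assume "partition_on {1..n} P" "B \<in> P"
  then have "B \<subseteq> {1..n}"
    by (auto simp: partition_on_def)
  then show "Digraph_Component.connected (with_proj (strip_graph n) \<restriction> B) \<longleftrightarrow> narrow_gaps B"
    by (rule connected_strip_iff)
qed

lemma finite_strip_divisions: "finite (strip_divisions n)"
  unfolding strip_divisions_def using finitely_many_partition_on[of "{1..n}"] by auto

lemma finite_division: "P \<in> strip_divisions n \<Longrightarrow> finite P"
  by (auto simp: strip_divisions_def intro: finite_elements[of "{1..n}"])

lemma division_block_subset: "P \<in> strip_divisions n \<Longrightarrow> B \<in> P \<Longrightarrow> B \<subseteq> {1..n}"
  by (auto simp: strip_divisions_def partition_on_def)

lemma division_block_unique:
  "P \<in> strip_divisions n \<Longrightarrow> B \<in> P \<Longrightarrow> C \<in> P \<Longrightarrow> x \<in> B \<Longrightarrow> x \<in> C \<Longrightarrow> B = C"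
  by (auto simp: strip_divisions_def partition_on_def disjoint_def)

lemma division_block_exists:
  "P \<in> strip_divisions n \<Longrightarrow> x \<in> {1..n} \<Longrightarrow> \<exists>B\<in>P. x \<in> B"
  by (auto simp: strip_divisions_def partition_on_def)

text \<open>Grouping the divisions by their number of pieces gives the sums over \<open>k\<close>;
  the cut-off at \<open>n\<close> is harmless by \<open>num_divisions_eq_0\<close>.\<close>

lemma expected_pieces_altdef:
  "expected_pieces n = real (\<Sum>P\<in>strip_divisions n. card P) / real (card (strip_divisions n))"
proof -
  have le: "card P \<le> n" if "P \<in> strip_divisions n" for P
  proof (rule ccontr)
    assume "\<not> card P \<le> n"
    then have "num_divisions (card P) n = 0"
      by (intro num_divisions_eq_0) simp
    with that show False
      using finite_strip_divisions[of n] by (auto simp: num_divisions_def)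
  qed
  \<comment> \<open>The identity for \<open>g\<close> yields the numerator, the constant 1 the
    denominator.\<close>
  have fibres: "(\<Sum>P\<in>strip_divisions n. g (card P)) = (\<Sum>k\<le>n. g k * num_divisions k n)"
    for g :: "nat \<Rightarrow> nat"
  proof -
    have "(\<Sum>P\<in>strip_divisions n. g (card P)) =
        (\<Sum>k\<le>n. \<Sum>P\<in>{P \<in> strip_divisions n. card P = k}. g (card P))"
      using le finite_strip_divisions by (intro sum.group[symmetric]) auto
    also have "\<dots> = (\<Sum>k\<le>n. g k * num_divisions k n)"
      by (intro sum.cong) (auto simp: num_divisions_def)
    finally show ?thesis .
  qed
  show ?thesis
    using fibres[of "\<lambda>k. k"] fibres[of "\<lambda>_. 1"]
    unfolding expected_pieces_def by simp
qed

section \<open>Adding and removing the last hexagon\<close>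

definition together :: "nat \<Rightarrow> nat \<Rightarrow> nat set set \<Rightarrow> bool" where
  "together i j P \<longleftrightarrow> (\<exists>B\<in>P. i \<in> B \<and> j \<in> B)"

definition join :: "nat \<Rightarrow> nat \<Rightarrow> nat set set \<Rightarrow> nat set set" where
  "join i j P = (\<lambda>B. if i \<in> B then insert j B else B) ` P"

text \<open>The block \<open>{Suc n}\<close> restricts to the empty set, which a partition must not
  contain. This one map undoes every way of adding hexagon \<open>Suc n\<close>.\<close>

definition trim :: "nat \<Rightarrow> nat set set \<Rightarrow> nat set set" where
  "trim n P = (\<inter>) {1..n} ` P - {{}}"

text \<open>The new element is the largest, so the only new demand is on the former maximum of
  \<open>B\<close>, which must reach \<open>Suc n\<close> in a step of at most 2.\<close>

lemma narrow_gaps_insert_Suc: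
  assumes "B \<subseteq> {1..n}" "B \<noteq> {}"
  shows "narrow_gaps (insert (Suc n) B) \<longleftrightarrow> narrow_gaps B \<and> (n \<in> B \<or> n - 1 \<in> B)"
proof
  assume L: "narrow_gaps (insert (Suc n) B)"
  have fin: "finite B"
    using assms(1) finite_subset by blast
  define m where "m = Max B"
  have m: "m \<in> B" "\<And>x. x \<in> B \<Longrightarrow> x \<le> m"
    using fin assms(2) by (auto simp: m_def)
  then have "1 \<le> m" "m \<le> n"
    using assms(1) by auto
  then have "m + 1 \<in> insert (Suc n) B \<or> m + 2 \<in> insert (Suc n) B"
    using L m(1) by (auto simp: narrow_gaps_def)
  moreover have "m + 1 \<notin> B" "m + 2 \<notin> B"
    using m(2)[of "m + 1"] m(2)[of "m + 2"] by auto
  ultimately have "m = n \<or> m = n - 1"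
    by auto
  with m(1) have "n \<in> B \<or> n - 1 \<in> B"
    by auto
  moreover have "x + 1 \<in> B \<or> x + 2 \<in> B" if "x \<in> B" "y \<in> B" "x < y" for x y
  proof -
    have "x + 1 \<in> insert (Suc n) B \<or> x + 2 \<in> insert (Suc n) B"
      using L that unfolding narrow_gaps_def by blast
    \<comment> \<open>If the element found is \<open>Suc n\<close>, then
      \<open>x + 2 = Suc n\<close>, because \<open>x < y\<close> and \<open>y\<close> is at most
      \<open>n\<close>. This forces \<open>y = x + 1\<close>, and \<open>y\<close> lies in
      \<open>B\<close>.\<close>
    moreover have "y \<le> n"
      using that assms by auto
    moreover have "x + 1 = y \<or> x + 2 \<le> y"
      using that by linarith
    ultimately show ?thesis
      using that by auto
  qed
  ultimately show "narrow_gaps B \<and> (n \<in> B \<or> n - 1 \<in> B)"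
    using assms(2) by (simp add: narrow_gaps_def)
next
  assume R: "narrow_gaps B \<and> (n \<in> B \<or> n - 1 \<in> B)"
  have "x + 1 \<in> insert (Suc n) B \<or> x + 2 \<in> insert (Suc n) B"
    if "x \<in> insert (Suc n) B" "y \<in> insert (Suc n) B" "x < y" for x y
  proof -
    have x: "x \<in> B" "x \<le> n" "1 \<le> x"
      using that assms(1) by auto
    show ?thesis
    \<comment> \<open>Below \<open>n - 1\<close> there is a larger element of \<open>B\<close>, so
      the gap condition of \<open>B\<close> applies; otherwise \<open>x\<close> is
      \<open>n - 1\<close> or \<open>n\<close>, and \<open>Suc n\<close> is within reach.\<close>
    proof (cases "x < n - 1")
      case True
      with R x obtain z where "z \<in> B" "x < z"
        by (metis less_imp_diff_less less_le_trans nat_less_le diff_le_self)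
      with R x show ?thesis
        by (auto simp: narrow_gaps_def)
    next
      case False
      with x show ?thesis
        by auto
    qed
  qed
  then show "narrow_gaps (insert (Suc n) B)"
    by (simp add: narrow_gaps_def)
qed

lemma narrow_gaps_singleton: "narrow_gaps {x}"
  by (simp add: narrow_gaps_def)

lemma insert_singleton_division:
  assumes "P \<in> strip_divisions n"
  shows "insert {Suc n} P \<in> strip_divisions (Suc n)"
proof -
  have "{1..Suc n} - {Suc n} = {1..n}"
    by auto
  then have "partition_on {1..Suc n} (insert {Suc n} P)"
    using assms division_block_subset[OF assms]
    by (subst partition_on_insert) (auto simp: strip_divisions_def disjnt_def)
  then show ?thesis
    using assms narrow_gaps_singleton by (auto simp: strip_divisions_altdef)
qed

text \<open>Only one block contains \<open>i\<close>, so the blocks stay disjoint; the enlarged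
  block stays connected because \<open>i\<close> is adjacent to \<open>Suc n\<close>.\<close>

lemma join_division:
  assumes P: "P \<in> strip_divisions n" and i: "i \<in> {1..n}" "i = n \<or> i = n - 1"
  shows "join i (Suc n) P \<in> strip_divisions (Suc n)"
proof -
  obtain C where C: "C \<in> P" "i \<in> C"
    using division_block_exists[OF P i(1)] by blast
  have part: "\<Union>P = {1..n}" "{} \<notin> P"
    using P by (auto simp: strip_divisions_def partition_on_def)
  have "\<Union>(join i (Suc n) P) = insert (Suc n) (\<Union>P)"
    using C by (auto simp: join_def split: if_splits)
  with part have "\<Union>(join i (Suc n) P) = {1..Suc n}"
    by auto
  moreover have "{} \<notin> join i (Suc n) P"
    using part by (auto simp: join_def split: if_splits)
  moreover have "disjoint (join i (Suc n) P)"
  proof (rule disjointI)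
    fix X Y assume "X \<in> join i (Suc n) P" "Y \<in> join i (Suc n) P" "X \<noteq> Y"
    then obtain B D where BD: "B \<in> P" "D \<in> P" "B \<noteq> D"
      "X = (if i \<in> B then insert (Suc n) B else B)" "Y = (if i \<in> D then insert (Suc n) D else D)"
      unfolding join_def by blast
    moreover have "B \<inter> D = {}"
      using BD division_block_unique[OF P] by blast
    moreover have "Suc n \<notin> B" "Suc n \<notin> D"
      using BD division_block_subset[OF P] by fastforce+
    ultimately show "X \<inter> Y = {}"
      by auto
  qed
  moreover have "narrow_gaps X" if X: "X \<in> join i (Suc n) P" for X
  proof -
    obtain B where B: "B \<in> P" "X = (if i \<in> B then insert (Suc n) B else B)"
      using X by (auto simp: join_def)
    have "narrow_gaps B"
      using P B by (simp add: strip_divisions_altdef)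
    with B i show ?thesis
      using narrow_gaps_insert_Suc[OF division_block_subset[OF P B(1)]] by auto
  qed
  ultimately show ?thesis
    by (simp add: strip_divisions_altdef partition_on_def)
qed

text \<open>The last hexagon is never a cut vertex of its block: this is the forward direction of
  \<open>narrow_gaps_insert_Suc\<close>.\<close>

lemma trim_division:
  assumes P: "P \<in> strip_divisions (Suc n)"
  shows "trim n P \<in> strip_divisions n"
proof -
  have "partition_on ({1..n} \<inter> {1..Suc n}) (trim n P)"
    unfolding trim_def using P by (intro partition_on_restrict) (simp add: strip_divisions_def)
  moreover have "{1..n} \<inter> {1..Suc n} = {1..n}"
    by auto
  moreover have "narrow_gaps X" if X: "X \<in> trim n P" for X
  proof -
    obtain B where B: "B \<in> P" "X = {1..n} \<inter> B" "X \<noteq> {}"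
      using X by (auto simp: trim_def)
    have "narrow_gaps B"
      using P B by (simp add: strip_divisions_altdef)
    moreover have "B = X \<or> B = insert (Suc n) X"
      using division_block_subset[OF P B(1)] B(2) by (auto simp: le_Suc_eq)
    moreover have "X \<subseteq> {1..n}"
      using B by simp
    ultimately show ?thesis
      using narrow_gaps_insert_Suc[of X n] B(3) by metis
  qed
  ultimately show ?thesis
    by (simp add: strip_divisions_altdef)
qed

lemma together_trim:
  "x \<in> {1..n} \<Longrightarrow> y \<in> {1..n} \<Longrightarrow> together x y (trim n P) \<longleftrightarrow> together x y P"
  unfolding together_def trim_def by blast

lemma trim_insert_singleton:
  assumes P: "P \<in> strip_divisions n"
  shows "trim n (insert {Suc n} P) = P"
proof -
  have "{1..n} \<inter> B = B" if "B \<in> P" for B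
    using division_block_subset[OF P that] by auto
  moreover have "{} \<notin> P"
    using P by (auto simp: strip_divisions_def partition_on_def)
  ultimately show ?thesis
    by (auto simp: trim_def)
qed

lemma trim_join:
  assumes P: "P \<in> strip_divisions n"
  shows "trim n (join i (Suc n) P) = P"
proof -
  have "{1..n} \<inter> B = B" if "B \<in> P" for B
    using division_block_subset[OF P that] by auto
  then have "{1..n} \<inter> (if i \<in> B then insert (Suc n) B else B) = B" if "B \<in> P" for B
    using that by simp
  then have "(\<inter>) {1..n} ` join i (Suc n) P = (\<lambda>B. B) ` P"
    unfolding join_def image_image by (intro image_cong refl)
  moreover have "{} \<notin> P"
    using P by (auto simp: strip_divisions_def partition_on_def)
  ultimately show ?thesis
    by (simp add: trim_def)
qed

lemma insert_singleton_trim: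
  assumes P: "P \<in> strip_divisions (Suc n)" and "{Suc n} \<in> P"
  shows "insert {Suc n} (trim n P) = P"
proof -
  have "{1..n} \<inter> B = B" if "B \<in> P" "B \<noteq> {Suc n}" for B
  proof -
    have "Suc n \<notin> B"
      using division_block_unique[OF P that(1) assms(2), of "Suc n"] that(2) by auto
    with division_block_subset[OF P that(1)] show ?thesis
      by (auto simp: le_Suc_eq)
  qed
  moreover have "{} \<notin> P"
    using P by (auto simp: strip_divisions_def partition_on_def)
  ultimately have "trim n P = P - {{Suc n}}"
    by (fastforce simp: trim_def)
  with assms(2) show ?thesis
    by auto
qed

text \<open>The hexagon \<open>i\<close> marks the block that lost \<open>Suc n\<close>, so the lost
  element can be put back.\<close>

lemma join_trim:
  assumes P: "P \<in> strip_divisions (Suc n)" and i: "i \<in> {1..n}" and t: "together i (Suc n) P"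
  shows "join i (Suc n) (trim n P) = P"
proof -
  obtain C where C: "C \<in> P" "i \<in> C" "Suc n \<in> C"
    using t by (auto simp: together_def)
  \<comment> \<open>The block of \<open>Suc n\<close> also contains \<open>i\<close>, so no block
    restricts to the empty set and \<open>trim\<close> discards nothing.\<close>
  have ne: "{1..n} \<inter> B \<noteq> {}" if "B \<in> P" for B
  proof (cases "B = C")
    case False
    then have "Suc n \<notin> B"
      using division_block_unique[OF P that C(1)] C by auto
    moreover have "B \<noteq> {}"
      using P that by (auto simp: strip_divisions_def partition_on_def)
    ultimately show ?thesis
      using division_block_subset[OF P that] by (fastforce simp: le_Suc_eq)
  qed (use C i in auto)
  have "(if i \<in> {1..n} \<inter> B then insert (Suc n) ({1..n} \<inter> B) else {1..n} \<inter> B) = B"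
    if "B \<in> P" for B
  proof (cases "B = C")
    case True
    then show ?thesis
      using C i division_block_subset[OF P that] by (auto simp: le_Suc_eq)
  next
    case False
    then have "Suc n \<notin> B" "i \<notin> B"
      using division_block_unique[OF P that C(1)] C by auto
    then show ?thesis
      using division_block_subset[OF P that] by (auto simp: le_Suc_eq)
  qed
  then have "(\<lambda>B. if i \<in> B then insert (Suc n) B else B) ` ((\<inter>) {1..n} ` P) = (\<lambda>B. B) ` P"
    unfolding image_image by (intro image_cong refl)
  moreover have "trim n P = (\<inter>) {1..n} ` P"
    using ne by (auto simp: trim_def)
  ultimately show ?thesis
    by (simp only: join_def image_ident)
qed

text \<open>The block of \<open>Suc n\<close> after the join is the old block of \<open>i\<close>
  enlarged. With \<open>i\<close> and \<open>j\<close> among \<open>n - 1\<close> and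
  \<open>n\<close>, this decides whether the result is fused.\<close>

lemma together_join:
  assumes P: "P \<in> strip_divisions n" and "i \<in> {1..n}" "j \<in> {1..n}"
  shows "together j (Suc n) (join i (Suc n) P) \<longleftrightarrow> together i j P"
proof -
  have "Suc n \<notin> B" if "B \<in> P" for B
    using division_block_subset[OF P that] by auto
  moreover have "j \<noteq> Suc n"
    using assms by auto
  ultimately show ?thesis
    by (auto simp: together_def join_def)
qed

lemma together_self: "P \<in> strip_divisions n \<Longrightarrow> i \<in> {1..n} \<Longrightarrow> together i i P"
  using division_block_exists by (auto simp: together_def)

lemma not_together_singleton:
  assumes "P \<in> strip_divisions n" "{j} \<in> P" "i \<noteq> j"
  shows "\<not> together i j P"
proof
  assume "together i j P"
  then obtain B where "B \<in> P" "i \<in> B" "j \<in> B"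
    by (auto simp: together_def)
  then have "B = {j}"
    using division_block_unique[OF assms(1) _ assms(2)] by blast
  with \<open>i \<in> B\<close> assms(3) show False
    by simp
qed

lemma card_insert_singleton:
  assumes "P \<in> strip_divisions n"
  shows "card (insert {Suc n} P) = Suc (card P)"
proof -
  have "{Suc n} \<notin> P"
    using division_block_subset[OF assms] by fastforce
  then show ?thesis
    using finite_division[OF assms] by simp
qed

lemma card_join:
  assumes P: "P \<in> strip_divisions n"
  shows "card (join i (Suc n) P) = card P"
proof -
  have "Suc n \<notin> B" if "B \<in> P" for B
    using division_block_subset[OF P that] by auto
  then have "inj_on (\<lambda>B. if i \<in> B then insert (Suc n) B else B) P"
    by (intro inj_onI) (metis insertI1 insert_ident)
  then show ?thesis
    unfolding join_def by (rule card_image)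
qed

section \<open>Fused and broken divisions, one step longer\<close>

text \<open>A strip of length 1 is counted as fused, so that the recurrences start at \<open>n = 1\<close>.\<close>

definition fused :: "nat \<Rightarrow> nat set set set" where
  "fused n = {P \<in> strip_divisions n. n = 1 \<or> together (n - 1) n P}"

definition broken :: "nat \<Rightarrow> nat set set set" where
  "broken n = strip_divisions n - fused n"

lemma bij_betw_join_fused:
  assumes "n \<ge> 1"
  shows "bij_betw (join n (Suc n)) (strip_divisions n) (fused (Suc n))"
proof (rule bij_betw_byWitness[where f' = "trim n"])
  show "join n (Suc n) ` strip_divisions n \<subseteq> fused (Suc n)"
  proof (rule image_subsetI)
    fix P assume "P \<in> strip_divisions n"
    then show "join n (Suc n) P \<in> fused (Suc n)"
      using assms join_division[of P n n] together_join[of P n n n] together_self[of P n n]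
      by (simp add: fused_def)
  qed
  show "\<forall>P\<in>fused (Suc n). join n (Suc n) (trim n P) = P"
    using assms join_trim[of _ n n] by (auto simp: fused_def)
  show "\<forall>P\<in>strip_divisions n. trim n (join n (Suc n) P) = P"
    using trim_join by blast
  show "trim n ` fused (Suc n) \<subseteq> strip_divisions n"
    using trim_division unfolding fused_def by blast
qed

lemma bij_betw_insert_singleton:
  "bij_betw (insert {Suc n}) (strip_divisions n) {P \<in> strip_divisions (Suc n). {Suc n} \<in> P}"
proof (rule bij_betw_byWitness[where f' = "trim n"])
  show "\<forall>P\<in>strip_divisions n. trim n (insert {Suc n} P) = P"
    using trim_insert_singleton by blast
  show "\<forall>P\<in>{P \<in> strip_divisions (Suc n). {Suc n} \<in> P}. insert {Suc n} (trim n P) = P"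
  proof
    fix P assume "P \<in> {P \<in> strip_divisions (Suc n). {Suc n} \<in> P}"
    then show "insert {Suc n} (trim n P) = P"
      by (intro insert_singleton_trim) simp_all
  qed
  show "insert {Suc n} ` strip_divisions n \<subseteq> {P \<in> strip_divisions (Suc n). {Suc n} \<in> P}"
    by (intro image_subsetI CollectI conjI insert_singleton_division insertI1)
  show "trim n ` {P \<in> strip_divisions (Suc n). {Suc n} \<in> P} \<subseteq> strip_divisions n"
    by (intro image_subsetI trim_division) simp
qed

text \<open>If \<open>n - 1\<close> and \<open>n\<close> share a block, joining at
  \<open>n - 1\<close> is the same as joining at \<open>n\<close>; only broken divisions give
  something new. Hexagon \<open>n - 1\<close> exists from \<open>n = 2\<close> on.\<close>

lemma bij_betw_join_broken:
  assumes "n \<ge> 2"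
  shows "bij_betw (join (n - 1) (Suc n)) (broken n)
    {P \<in> strip_divisions (Suc n). together (n - 1) (Suc n) P \<and> \<not> together n (Suc n) P}"
    (is "bij_betw _ _ ?R")
proof (rule bij_betw_byWitness[where f' = "trim n"])
  have n: "n - 1 \<in> {1..n}" "n \<in> {1..n}"
    using assms by auto
  show "join (n - 1) (Suc n) ` broken n \<subseteq> ?R"
  proof (rule image_subsetI)
    fix P assume "P \<in> broken n"
    then have "P \<in> strip_divisions n" "\<not> together (n - 1) n P"
      by (auto simp: broken_def fused_def)
    then show "join (n - 1) (Suc n) P \<in> ?R"
      using n join_division[of P n "n - 1"] together_join[of P n "n - 1"]
        together_self[of P n "n - 1"]
      by simp
  qed
  show "\<forall>P\<in>?R. join (n - 1) (Suc n) (trim n P) = P"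
    using n join_trim by blast
  \<comment> \<open>A block shared by \<open>n - 1\<close> and \<open>n\<close> would be the one
    that \<open>n - 1\<close> shares with \<open>Suc n\<close>, putting \<open>n\<close> and
    \<open>Suc n\<close> together.\<close>
  have "\<not> together (n - 1) n P"
    if "P \<in> strip_divisions (Suc n)" "together (n - 1) (Suc n) P" "\<not> together n (Suc n) P" for P
    using that division_block_unique[OF that(1), of _ _ "n - 1"] unfolding together_def by blast
  then show "trim n ` ?R \<subseteq> broken n"
    using assms trim_division together_trim[OF n]
    by (auto simp: broken_def fused_def)
  show "\<forall>P\<in>broken n. trim n (join (n - 1) (Suc n) P) = P"
    using trim_join unfolding broken_def by blast
qed

text \<open>If \<open>Suc n\<close> is not alone, the rest of its block contains \<open>n\<close> or
  \<open>n - 1\<close> by \<open>narrow_gaps_insert_Suc\<close>, and brokenness excludes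
  \<open>n\<close>.\<close>

lemma broken_Suc:
  assumes "n \<ge> 1"
  shows "broken (Suc n) = {P \<in> strip_divisions (Suc n). {Suc n} \<in> P} \<union>
    {P \<in> strip_divisions (Suc n). together (n - 1) (Suc n) P \<and> \<not> together n (Suc n) P}"
    (is "_ = ?N \<union> ?R")
proof
  show "broken (Suc n) \<subseteq> ?N \<union> ?R"
  proof
    fix P assume "P \<in> broken (Suc n)"
    then have P: "P \<in> strip_divisions (Suc n)" "\<not> together n (Suc n) P"
      using assms by (auto simp: broken_def fused_def)
    obtain C where C: "C \<in> P" "Suc n \<in> C"
      using division_block_exists[OF P(1), of "Suc n"] by auto
    have sub: "C - {Suc n} \<subseteq> {1..n}"
      using division_block_subset[OF P(1) C(1)] by (auto simp: le_Suc_eq)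
    show "P \<in> ?N \<union> ?R"
    proof (cases "C - {Suc n} = {}")
      case True
      with C have "C = {Suc n}"
        by auto
      with C P show ?thesis
        by auto
    next
      case False
      have "narrow_gaps (insert (Suc n) (C - {Suc n}))"
        using P C by (simp add: strip_divisions_altdef insert_absorb)
      then have "n \<in> C \<or> n - 1 \<in> C"
        using narrow_gaps_insert_Suc[OF sub False] by auto
      with P C show ?thesis
        by (auto simp: together_def)
    qed
  qed
  show "?N \<union> ?R \<subseteq> broken (Suc n)"
    using assms not_together_singleton[of _ "Suc n" "Suc n" n] by (auto simp: broken_def fused_def)
qed

lemma broken_1: "broken 1 = {}"
  by (auto simp: broken_def fused_def)

lemma fused_1: "fused 1 = {{{1}}}"
proof -
  have "P = {{1}}" if "partition_on {1..1} P" for P :: "nat set set"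
  proof -
    have U: "\<Union>P = {1}" and "{} \<notin> P"
      using that by (auto simp: partition_on_def)
    then have "B = {1}" if "B \<in> P" for B
      using that by (metis Union_upper subset_singletonD)
    moreover have "P \<noteq> {}"
      using U by auto
    ultimately show ?thesis
      by blast
  qed
  moreover have "partition_on {1..1} {{1::nat}}"
    by (simp add: partition_on_def)
  ultimately have "strip_divisions 1 = {{{1}}}"
    unfolding strip_divisions_altdef using narrow_gaps_singleton[of 1] by blast
  then show ?thesis
    by (auto simp: fused_def)
qed

section \<open>Recurrences and formulas for the numbers of pieces\<close>

lemma sum_fused_Suc:
  fixes g :: "nat \<Rightarrow> real"
  assumes "n \<ge> 1"
  shows "(\<Sum>P\<in>fused (Suc n). g (card P)) = (\<Sum>P\<in>strip_divisions n. g (card P))"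
proof -
  have "(\<Sum>P\<in>fused (Suc n). g (card P)) = (\<Sum>P\<in>strip_divisions n. g (card (join n (Suc n) P)))"
    by (rule sum.reindex_bij_betw[OF bij_betw_join_fused[OF assms], symmetric])
  then show ?thesis
    by (simp add: card_join)
qed

text \<open>A new singleton raises the number of pieces by one, whereas joining at
  \<open>n - 1\<close> keeps it. The constant \<open>g\<close> gives the recurrence for counts, the
  identity that for pieces.\<close>

lemma sum_broken_Suc:
  fixes g :: "nat \<Rightarrow> real"
  assumes "n \<ge> 1"
  shows "(\<Sum>P\<in>broken (Suc n). g (card P)) =
    (\<Sum>P\<in>strip_divisions n. g (Suc (card P))) + (\<Sum>P\<in>broken n. g (card P))"
proof -
  let ?N = "{P \<in> strip_divisions (Suc n). {Suc n} \<in> P}"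
  let ?R = "{P \<in> strip_divisions (Suc n). together (n - 1) (Suc n) P \<and> \<not> together n (Suc n) P}"
  have "?N \<inter> ?R = {}"
    using not_together_singleton[of _ "Suc n" "Suc n" "n - 1"] by auto
  then have "(\<Sum>P\<in>broken (Suc n). g (card P)) = (\<Sum>P\<in>?N. g (card P)) + (\<Sum>P\<in>?R. g (card P))"
    unfolding broken_Suc[OF assms] using finite_strip_divisions
    by (intro sum.union_disjoint) auto
  also have "(\<Sum>P\<in>?N. g (card P)) = (\<Sum>P\<in>strip_divisions n. g (Suc (card P)))"
    using sum.reindex_bij_betw[OF bij_betw_insert_singleton, of "\<lambda>P. g (card P)" n, symmetric]
    by (simp add: card_insert_singleton)
  also have "(\<Sum>P\<in>?R. g (card P)) = (\<Sum>P\<in>broken n. g (card P))"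
  \<comment> \<open>The bijection starts at \<open>n = 2\<close>. For \<open>n = 1\<close> both sums
    are empty, as there is no hexagon 0 and no broken division of length 1.\<close>
  proof (cases "n = 1")
    case True
    have "\<not> together 0 2 P" if "P \<in> strip_divisions 2" for P
      using division_block_subset[OF that] by (fastforce simp: together_def)
    then have R: "?R = {}"
      using True by (auto simp: numeral_2_eq_2)
    show ?thesis
      unfolding R using True broken_1 by simp
  next
    case False
    then have "n \<ge> 2"
      using assms by simp
    have "card (join (n - 1) (Suc n) P) = card P" if "P \<in> broken n" for P
      using that by (simp add: broken_def card_join)
    then show ?thesis
      using sum.reindex_bij_betw[OF bij_betw_join_broken[OF \<open>n \<ge> 2\<close>],
          of "\<lambda>P. g (card P)", symmetric]
      by simp
  qed
  finally show ?thesis .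
qed

lemma sum_strip_divisions:
  fixes g :: "nat set set \<Rightarrow> real"
  shows "(\<Sum>P\<in>strip_divisions n. g P) = (\<Sum>P\<in>fused n. g P) + (\<Sum>P\<in>broken n. g P)"
proof -
  have "fused n \<subseteq> strip_divisions n"
    by (auto simp: fused_def)
  then show ?thesis
    unfolding broken_def using sum.subset_diff[OF _ finite_strip_divisions, of "fused n" n g]
    by simp
qed

text \<open>With the initial values 1 and 0, the two counts are the Fibonacci numbers of index
  \<open>2 * n - 3\<close> and \<open>2 * n - 2\<close>, where index -1 has value 1.\<close>

lemma card_Suc:
  assumes "n \<ge> 1"
  shows "card (fused (Suc n)) = card (fused n) + card (broken n)"
    and "card (broken (Suc n)) = card (fused n) + 2 * card (broken n)"
  using sum_fused_Suc[OF assms, of "\<lambda>_. 1"] sum_broken_Suc[OF assms, of "\<lambda>_. 1"]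
    sum_strip_divisions[of "\<lambda>_. 1" n]
  by simp_all

text \<open>The totals obey the recurrence of the counts with a forcing term that itself solves it,
  hence the coefficients linear in \<open>n\<close>. Those of \<open>n\<close> form the matrix with
  rows (-1, 2) and (2, 1), whose square is 5 times the identity; after division by 5 its positive
  eigenvalue is the growth rate \<open>sqrt 5 / 5\<close>.\<close>

lemma sum_pieces:
  assumes "n \<ge> 1"
  shows "5 * (\<Sum>P\<in>fused n. real (card P)) =
      (6 - real n) * card (fused n) + (2 * real n - 3) * card (broken n) \<and>
    5 * (\<Sum>P\<in>broken n. real (card P)) =
      (2 * real n - 2) * card (fused n) + (real n + 6) * card (broken n)"
  using assms
proof (induction n rule: dec_induct)
  case base
  show ?case
    unfolding One_nat_def[symmetric] fused_1 broken_1 by simp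
next
  case (step n)
  note D = sum_strip_divisions[of "\<lambda>P. real (card P)" n] sum_strip_divisions[of "\<lambda>_. 1" n]
  have "(\<Sum>P\<in>strip_divisions n. real (Suc (card P))) =
      (\<Sum>P\<in>strip_divisions n. real (card P)) + card (strip_divisions n)"
    by (simp add: sum.distrib)
  with step D show ?case
    by (simp add: sum_fused_Suc sum_broken_Suc card_Suc algebra_simps)
qed

section \<open>Asymptotics of the expectation\<close>

lemma expected_pieces_closed_form:
  assumes "n \<ge> 1"
  shows "expected_pieces n =
    ((real n + 4) * card (fused n) + (3 * real n + 3) * card (broken n)) /
    (5 * (real (card (fused n)) + real (card (broken n))))"
proof -
  have "5 * (\<Sum>P\<in>strip_divisions n. real (card P)) =
      (real n + 4) * card (fused n) + (3 * real n + 3) * card (broken n)"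
    using sum_pieces[OF assms] sum_strip_divisions[of "\<lambda>P. real (card P)" n]
    by (simp add: algebra_simps)
  moreover have "real (card (strip_divisions n)) = real (card (fused n)) + real (card (broken n))"
    using sum_strip_divisions[of "\<lambda>_. 1" n] by simp
  moreover have "expected_pieces n =
      (5 * (\<Sum>P\<in>strip_divisions n. real (card P))) / (5 * real (card (strip_divisions n)))"
    by (simp add: expected_pieces_altdef)
  ultimately show ?thesis
    by simp
qed

text \<open>Makes the number of divisions at least \<open>n\<close>, so that in the numerator of the
  error a bounded multiple of \<open>n\<close> is absorbed by that number.\<close>

lemma card_ge:
  assumes "n \<ge> 1"
  shows "card (fused n) \<ge> 1 \<and> card (broken n) \<ge> n - 1"
  using assms
proof (induction n rule: dec_induct)
  case base
  show ?case
    unfolding One_nat_def[symmetric] fused_1 by simp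
next
  case (step n)
  then show ?case
    by (auto simp: card_Suc)
qed

text \<open>The factor \<open>(3 - sqrt 5) / 2\<close> of each step lies between 0 and 1, so the
  initial bound persists; at \<open>n = 1\<close> the deviation is minus the golden ratio, whence
  the 2.\<close>

lemma golden_ratio_deviation:
  assumes "n \<ge> 1"
  shows "\<bar>real (card (broken n)) - (1 + sqrt 5) / 2 * card (fused n)\<bar> \<le> 2"
  using assms
proof (induction n rule: dec_induct)
  case base
  have "sqrt 5 \<le> 3"
    by (rule real_le_lsqrt) auto
  then show ?case
    unfolding One_nat_def[symmetric] fused_1 broken_1 by simp
next
  case (step n)
  define A B where "A = real (card (fused n))" and "B = real (card (broken n))"
  have "sqrt 5 \<le> 3" "1 \<le> sqrt 5"
    by (rule real_le_lsqrt; simp) (rule real_le_rsqrt; simp)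
  then have c: "\<bar>(3 - sqrt 5) / 2\<bar> \<le> 1"
    by simp
  have "real (card (broken (Suc n))) - (1 + sqrt 5) / 2 * card (fused (Suc n)) =
      (A + 2 * B) - (1 + sqrt 5) / 2 * (A + B)"
    using step by (simp add: card_Suc A_def B_def)
  also have "\<dots> = (3 - sqrt 5) / 2 * (B - (1 + sqrt 5) / 2 * A)"
    by (simp add: field_simps)
  finally have eq: "real (card (broken (Suc n))) - (1 + sqrt 5) / 2 * card (fused (Suc n)) =
      (3 - sqrt 5) / 2 * (B - (1 + sqrt 5) / 2 * A)" .
  have "\<bar>(3 - sqrt 5) / 2\<bar> * \<bar>B - (1 + sqrt 5) / 2 * A\<bar> \<le> 1 * 2"
    using c step.IH unfolding A_def B_def by (intro mult_mono) auto
  then show ?case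
    unfolding eq abs_mult by simp
qed

lemma expected_pieces_ratio:
  assumes "n \<ge> 1"
  shows "\<bar>expected_pieces n / (sqrt 5 / 5 * real n) - 1\<bar> \<le> 3 / real n"
proof -
  define A B where "A = real (card (fused n))" and "B = real (card (broken n))"
  define d where "d = B - (1 + sqrt 5) / 2 * A"
  have d: "\<bar>d\<bar> \<le> 2"
    using golden_ratio_deviation[OF assms] by (simp add: d_def A_def B_def)
  have s: "2 \<le> sqrt 5" "sqrt 5 \<le> 3"
    by (rule real_le_rsqrt; simp) (rule real_le_lsqrt; simp)
  have "A \<ge> 0" "B \<ge> 0" and AB: "A + B \<ge> real n" and n: "real n > 0"
    using card_ge[OF assms] assms by (auto simp: A_def B_def)
  have "expected_pieces n / (sqrt 5 / 5 * real n) - 1 =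
      ((real n + 4) * A + (3 * real n + 3) * B) / (sqrt 5 * real n * (A + B)) - 1"
  proof -
    have "5 * (A + B) * (sqrt 5 / 5 * real n) = sqrt 5 * real n * (A + B)"
      by simp
    then show ?thesis
      using expected_pieces_closed_form[OF assms, folded A_def B_def]
      by (simp only: divide_divide_eq_left)
  qed
  also have "\<dots> = ((real n + 4) * A + (3 * real n + 3) * B - sqrt 5 * real n * (A + B)) /
      (sqrt 5 * real n * (A + B))"
    using n AB by (simp add: diff_divide_distrib)
  \<comment> \<open>As \<open>(3 - sqrt 5) * (1 + sqrt 5) / 2 = sqrt 5 - 1\<close>, all terms
    containing \<open>n\<close> combine into a multiple of the bounded \<open>d\<close>.\<close>
  also have "(real n + 4) * A + (3 * real n + 3) * B - sqrt 5 * real n * (A + B) =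
      real n * ((3 - sqrt 5) * d) + 4 * A + 3 * B"
    by (simp add: d_def field_simps)
  finally have eq: "expected_pieces n / (sqrt 5 / 5 * real n) - 1 =
      (real n * ((3 - sqrt 5) * d) + 4 * A + 3 * B) / (sqrt 5 * real n * (A + B))" .
  have "\<bar>(3 - sqrt 5) * d\<bar> \<le> 1 * 2"
    unfolding abs_mult using s d by (intro mult_mono) auto
  then have "\<bar>real n * ((3 - sqrt 5) * d)\<bar> \<le> real n * 2"
    unfolding abs_mult[of "real n"] by (intro mult_mono) auto
  \<comment> \<open>Here \<open>2 * n\<close> is at most \<open>2 * (A + B)\<close>, and
    \<open>4 * A + 3 * B\<close> at most \<open>4 * (A + B)\<close>.\<close>
  moreover have "\<bar>t + 4 * A + 3 * B\<bar> \<le> 6 * (A + B)" if "\<bar>t\<bar> \<le> real n * 2" for t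
    using that AB \<open>A \<ge> 0\<close> \<open>B \<ge> 0\<close> unfolding abs_le_iff by simp
  ultimately have "\<bar>real n * ((3 - sqrt 5) * d) + 4 * A + 3 * B\<bar> \<le> 6 * (A + B)"
    by blast
  moreover have "2 * real n * (A + B) \<le> sqrt 5 * real n * (A + B)"
    using s n AB by (intro mult_right_mono) auto
  ultimately have "\<bar>expected_pieces n / (sqrt 5 / 5 * real n) - 1\<bar> \<le>
      6 * (A + B) / (2 * real n * (A + B))"
    unfolding eq abs_divide using n AB s by (intro frac_le) auto
  also have "\<dots> = 3 / real n"
    using n AB mult_divide_mult_cancel_right[of "A + B" 6 "2 * real n"] by simp
  finally show ?thesis .
qed

theorem theorem11:
  "expected_pieces \<sim>[at_top] (\<lambda>n. sqrt 5 / 5 * real n) \<and>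
   \<bar>sqrt 5 / 5 - 0.447214\<bar> < 5 / 10 ^ 7"
proof
  have "(\<lambda>n. 3 / real n) \<longlonglongrightarrow> 0"
    by (rule lim_const_over_n)
  moreover have "\<forall>\<^sub>F n in sequentially.
      norm (expected_pieces n / (sqrt 5 / 5 * real n) - 1) \<le> norm (3 / real n) * 1"
    using eventually_ge_at_top[of 1] by eventually_elim (use expected_pieces_ratio in simp)
  ultimately have "(\<lambda>n. expected_pieces n / (sqrt 5 / 5 * real n) - 1) \<longlonglongrightarrow> 0"
    by (rule tendsto_0_le)
  then have "(\<lambda>n. expected_pieces n / (sqrt 5 / 5 * real n)) \<longlonglongrightarrow> 1"
    by (simp add: LIM_zero_iff)
  then show "expected_pieces \<sim>[at_top] (\<lambda>n. sqrt 5 / 5 * real n)"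
    by (rule asymp_equivI')
  \<comment> \<open>The bounds are 5 times \<open>0.447214 - 5 / 10 ^ 7\<close> and 5 times
    \<open>0.447214 + 5 / 10 ^ 7\<close>.\<close>
  have "2.2360675 < sqrt 5" "sqrt 5 < 2.2360725"
    by (rule real_less_rsqrt; simp add: power2_eq_square)
       (rule real_less_lsqrt; simp add: power2_eq_square)
  then show "\<bar>sqrt 5 / 5 - 0.447214\<bar> < 5 / 10 ^ 7"
    unfolding abs_less_iff by simp
qed

end
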